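(* Let $r\ge 1$, $m_0\ge m_1\ge\cdots\ge m_r\ge 1$, $A_0=\sigma\sigma^*$ a real symmetric positive semidefinite $m_0\times m_0$ matrix, and $B_k$ a real $m_{k-1}\times m_k$ matrix of rank $m_k$ for $k=1,\dots,r$. Let $(P_t)_{t\ge0}$ be the semigroup on $\mathbb{R}^{m_0}\times\cdots\times\mathbb{R}^{m_r}$ of the diffusion $dX_1(t)=\sigma\,dB(t)$, $dX_{k+1}(t)=B_k^*X_k(t)\,dt$ $(1\le k\le r)$, with carré du champ $\Gamma$. Let $f\in C^2(\mathbb{R}^{m_0}\times\cdots\times\mathbb{R}^{m_r})$ be a positive, globally Lipschitz and bounded function. Then for every $t\ge 0$ and every $x\in\mathbb{R}^{m_0}\times\cdots\times\mathbb{R}^{m_r}$, $$2P_tf(x)\,\Gamma(\ln P_tf)(x)\le P_t\left(f\left\langle E(-t)AE^*(-t)\nabla\ln f,\nabla\ln f\right\rangle\right)(x)$$ and $$P_tf(x)\left\langle E(t)AE^*(t)\nabla\ln P_tf(x),\nabla\ln P_tf(x)\right\rangle\le 2P_t\left(f\,\Gamma(\ln f)\right)(x).$$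
   Context: Let $N=\sum_{k=0}^rm_k$, so $\mathbb{R}^{m_0}\times\cdots\times\mathbb{R}^{m_r}=\mathbb{R}^N$. In block form (block sizes $m_0,\dots,m_r$), $A=\begin{pmatrix}A_0&0\\0&0\end{pmatrix}$ is the $N\times N$ matrix with upper left block $A_0$ and zeros elsewhere, and $B$ is the $N\times N$ matrix whose $(k,k+1)$ block is $B_k$ for $1\le k\le r$ and all of whose other blocks are zero. $M^*$ denotes the transpose of a matrix $M$; $E(t)=\exp(-tB^* )$ for $t\in\mathbb{R}$ and $E^*(t)$ is its transpose. $\sigma$ is a constant $m_0\times m_0$ matrix with $\sigma\sigma^*=A_0$, $B(t)$ (with time argument, in the stochastic differential equation) is a standard Brownian motion in $\mathbb{R}^{m_0}$, and $X_i(t)$ is $\mathbb{R}^{m_{i-1}}$-valued. For $\mathbf{X}_t=(X_1(t),\dots,X_{r+1}(t))$, $P_tf(x)=\mathbb{E}^x[f(\mathbf{X}_t)]$, where $\mathbf{X}_0=x$. The generator is $\mathcal{L}=\frac12\mathrm{div}(AD)+\langle x,BD\rangle$, $D=(\partial_{x_1},\dots,\partial_{x_N})$. $\nabla f$ is the full gradient in $\mathbb{R}^N$ and $\langle\cdot,\cdot\rangle$ the Euclidean inner product. $\Gamma(f,g)=\frac12(\mathcal{L}(fg)-f\mathcal{L}g-g\mathcal{L}f)$ and $\Gamma(f)=\Gamma(f,f)$; explicitly $\Gamma(f)=\frac12\langle A\nabla f,\nabla f\rangle$, and this formula is used for all $C^1$ functions $f$. *)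

theory Defs
  imports "HOL-Probability.Probability" "Jordan_Normal_Form.DL_Rank"
begin

text \<open>
  The blocks \<open>A\<^sub>0\<close>, \<open>\<sigma>\<close>, \<open>B\<^sub>k\<close>, whose sizes vary with \<open>k\<close>, are matrices of \<open>Jordan_Normal_Form\<close>; the space
  \<open>R\<^sup>N\<close> is \<open>real ^ 'n\<close>. The two are linked by a labelling \<open>c\<close> of the coordinates, a bijection from
  \<open>'n\<close> onto the pairs (block, position in the block). Blocks are numbered from 0, so
  block \<open>k\<close> of the state at time \<open>t\<close> is \<open>X\<^bsub>k+1\<^esub>(t)\<close>.
\<close>

definition block_labelling :: "nat \<Rightarrow> (nat \<Rightarrow> nat) \<Rightarrow> ('n \<Rightarrow> nat \<times> nat) \<Rightarrow> bool" where
  "block_labelling r m c \<longleftrightarrow> bij_betw c UNIV (SIGMA k:{..r}. {..<m k})"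

definition block :: "('n::finite \<Rightarrow> nat \<times> nat) \<Rightarrow> (nat \<Rightarrow> nat) \<Rightarrow> nat \<Rightarrow> real ^ 'n \<Rightarrow> real Matrix.vec" where
  "block c m k x = Matrix.vec (m k) (\<lambda>i. vec_nth x (inv_into UNIV c (k, i)))"

definition A_matrix :: "('n::finite \<Rightarrow> nat \<times> nat) \<Rightarrow> real Matrix.mat \<Rightarrow> real ^ 'n ^ 'n" where
  "A_matrix c A0 = (\<chi> a b. if fst (c a) = 0 \<and> fst (c b) = 0 then A0 $$ (snd (c a), snd (c b)) else 0)"

text \<open>With blocks numbered from 0, \<open>B k\<close> occupies the block in row \<open>k - 1\<close> and column \<open>k\<close>.\<close>

definition B_matrix :: "('n::finite \<Rightarrow> nat \<times> nat) \<Rightarrow> (nat \<Rightarrow> real Matrix.mat) \<Rightarrow> real ^ 'n ^ 'n" where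
  "B_matrix c B =
    (\<chi> a b. if fst (c b) = Suc (fst (c a)) then B (fst (c b)) $$ (snd (c a), snd (c b)) else 0)"

definition matrix_exp :: "real ^ 'n ^ 'n \<Rightarrow> real ^ 'n ^ 'n" where
  "matrix_exp M = (\<Sum>k. (1 / fact k) *\<^sub>R (((**) M ^^ k) (Finite_Cartesian_Product.mat 1)))"

definition E_matrix :: "real ^ 'n ^ 'n \<Rightarrow> real \<Rightarrow> real ^ 'n ^ 'n" where
  "E_matrix B t = matrix_exp ((- t) *\<^sub>R Finite_Cartesian_Product.transpose B)"

definition C2_function :: "(real ^ 'n \<Rightarrow> real) \<Rightarrow> bool" where
  "C2_function f \<longleftrightarrow> (\<exists>(g :: real ^ 'n \<Rightarrow> real ^ 'n) (H :: real ^ 'n \<Rightarrow> real ^ 'n ^ 'n).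
     (\<forall>x. (f has_derivative (\<lambda>h. inner (g x) h)) (at x)) \<and>
     (\<forall>x. (g has_derivative (\<lambda>h. H x *v h)) (at x)) \<and>
     continuous_on UNIV H)"

definition grad :: "(real ^ 'n \<Rightarrow> real) \<Rightarrow> real ^ 'n \<Rightarrow> real ^ 'n" where
  "grad f x = (\<chi> i. frechet_derivative f (at x) (axis i 1))"

definition carre_du_champ :: "real ^ 'n ^ 'n \<Rightarrow> (real ^ 'n \<Rightarrow> real) \<Rightarrow> real ^ 'n \<Rightarrow> real" where
  "carre_du_champ A f x = (1/2) * inner (A *v grad f x) (grad f x)"

text \<open>
  \<open>carre_du_champ\<close> is the explicit form, which makes sense for all \<open>C\<^sup>1\<close> functions. On \<open>C\<^sup>2\<close> functions it
  agrees with the form obtained from the generator, as lemma \<open>carre_du_champ_generator\<close> shows.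
\<close>

definition divergence :: "(real ^ 'n \<Rightarrow> real ^ 'n) \<Rightarrow> real ^ 'n \<Rightarrow> real" where
  "divergence F x = (\<Sum>i\<in>UNIV. vec_nth (grad (\<lambda>y. vec_nth (F y) i) x) i)"

definition generator ::
  "real ^ 'n ^ 'n \<Rightarrow> real ^ 'n ^ 'n \<Rightarrow> (real ^ 'n \<Rightarrow> real) \<Rightarrow> real ^ 'n \<Rightarrow> real" where
  "generator A B f x = (1/2) * divergence (\<lambda>y. A *v grad f y) x + inner x (B *v grad f x)"

lemma grad_nth:
  assumes "(f has_derivative L) (at x)"
  shows "vec_nth (grad f x) i = L (axis i 1)"
  unfolding grad_def frechet_derivative_at[OF assms, symmetric] by simp

lemma grad_eq:
  assumes "(f has_derivative (\<lambda>h. inner v h)) (at x)"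
  shows "grad f x = v"
  by (simp add: Finite_Cartesian_Product.vec_eq_iff grad_nth[OF assms] inner_axis)

lemma carre_du_champ_generator:
  fixes A B :: "real ^ 'n ^ 'n"
  assumes "C2_function f"
  shows "carre_du_champ A f x =
    (1/2) * (generator A B (\<lambda>y. f y * f y) x - f x * generator A B f x - f x * generator A B f x)"
proof -
  from assms obtain g :: "real ^ 'n \<Rightarrow> real ^ 'n" and H :: "real ^ 'n \<Rightarrow> real ^ 'n ^ 'n"
    where g: "\<And>x. (f has_derivative (\<lambda>h. inner (g x) h)) (at x)"
      and H: "\<And>x. (g has_derivative (\<lambda>h. H x *v h)) (at x)"
    unfolding C2_function_def by blast
  have gf: "grad f = g" using grad_eq[OF g] by blast
  have gff: "grad (\<lambda>y. f y * f y) = (\<lambda>y. (2 * f y) *\<^sub>R g y)"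
  proof
    fix y show "grad (\<lambda>y. f y * f y) y = (2 * f y) *\<^sub>R g y"
      by (rule grad_eq, rule has_derivative_eq_rhs[OF has_derivative_mult[OF g g]]) (auto simp: fun_eq_iff)
  qed
  have bl: "bounded_linear (\<lambda>v. vec_nth (A *v v) i)" for i
    by (intro bounded_linear_compose[OF bounded_linear_vec_nth] matrix_vector_mul_bounded_linear)
  have d1: "((\<lambda>y. vec_nth (A *v g y) i) has_derivative (\<lambda>h. vec_nth (A *v (H x *v h)) i)) (at x)" for i
    by (rule bounded_linear.has_derivative[OF bl H])
  have d2: "((\<lambda>y. vec_nth (A *v ((2 * f y) *\<^sub>R g y)) i) has_derivative
      (\<lambda>h. 2 * f x * vec_nth (A *v (H x *v h)) i + 2 * inner (g x) h * vec_nth (A *v g x) i)) (at x)" for i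
    unfolding matrix_vector_mult_scaleR vector_scaleR_component real_scaleR_def
    by (rule has_derivative_eq_rhs[OF has_derivative_mult[OF has_derivative_mult_right[OF g] d1]]) auto
  have div: "divergence (\<lambda>y. A *v ((2 * f y) *\<^sub>R g y)) x =
      2 * f x * divergence (\<lambda>y. A *v g y) x + 2 * inner (A *v g x) (g x)"
    unfolding divergence_def grad_nth[OF d1] grad_nth[OF d2]
    by (simp add: sum.distrib sum_distrib_left inner_axis inner_vec_def[of "A *v g x"] ac_simps)
  show ?thesis
    unfolding carre_du_champ_def generator_def gf gff div
    by (simp add: matrix_vector_mult_scaleR algebra_simps)
qed

text \<open>
  A standard Brownian motion in \<open>R\<^sup>d\<close>: \<open>W t \<omega> j\<close> is its \<open>j\<close>-th coordinate, only \<open>t \<ge> 0\<close> and \<open>j < d\<close>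
  being relevant. The law \<open>N(0, (t - s) I)\<close> of an increment is written as a product measure.
\<close>

definition std_brownian_motion ::
  "'w measure \<Rightarrow> nat \<Rightarrow> (real \<Rightarrow> 'w \<Rightarrow> nat \<Rightarrow> real) \<Rightarrow> bool" where
  "std_brownian_motion M d W \<longleftrightarrow>
     prob_space M \<and>
     (\<forall>t\<ge>0. \<forall>j<d. (\<lambda>\<omega>. W t \<omega> j) \<in> borel_measurable M) \<and>
     (AE \<omega> in M. \<forall>j<d. W 0 \<omega> j = 0) \<and>
     (AE \<omega> in M. \<forall>j<d. continuous_on {0..} (\<lambda>t. W t \<omega> j)) \<and>
     (\<forall>(n::nat) (t :: nat \<Rightarrow> real). 0 \<le> t 0 \<longrightarrow> (\<forall>i<n. t i < t (Suc i)) \<longrightarrow>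
        prob_space.indep_vars M (\<lambda>i. \<Pi>\<^sub>M j\<in>{..<d}. (borel :: real measure))
          (\<lambda>i \<omega>. \<lambda>j\<in>{..<d}. W (t (Suc i)) \<omega> j - W (t i) \<omega> j) {..<n}) \<and>
     (\<forall>s t. 0 \<le> s \<longrightarrow> s < t \<longrightarrow>
        distr M (\<Pi>\<^sub>M j\<in>{..<d}. (borel :: real measure)) (\<lambda>\<omega>. \<lambda>j\<in>{..<d}. W t \<omega> j - W s \<omega> j) =
        (\<Pi>\<^sub>M j\<in>{..<d}. density lborel (\<lambda>u. ennreal (normal_density 0 (sqrt (t - s)) u))))"

text \<open>
  The stochastic differential equation in integrated form, with initial value \<open>x\<close>. As \<open>\<sigma>\<close> is constant and the
  noise acts on block 0 only, no stochastic integral is needed.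
\<close>

definition diffusion_from ::
  "'w measure \<Rightarrow> (real \<Rightarrow> 'w \<Rightarrow> nat \<Rightarrow> real) \<Rightarrow> ('n::finite \<Rightarrow> nat \<times> nat) \<Rightarrow> nat \<Rightarrow> (nat \<Rightarrow> nat) \<Rightarrow>
   real Matrix.mat \<Rightarrow> (nat \<Rightarrow> real Matrix.mat) \<Rightarrow> real ^ 'n \<Rightarrow> (real \<Rightarrow> 'w \<Rightarrow> real ^ 'n) \<Rightarrow> bool" where
  "diffusion_from M W c r m \<sigma> B x X \<longleftrightarrow>
     (\<forall>t\<ge>0. X t \<in> borel_measurable M) \<and>
     (AE \<omega> in M. continuous_on {0..} (\<lambda>t. X t \<omega>)) \<and>
     (AE \<omega> in M. \<forall>t\<ge>0.
        block c m 0 (X t \<omega>) = block c m 0 x + \<sigma> *\<^sub>v Matrix.vec (m 0) (W t \<omega>) \<and>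
        (\<forall>k\<in>{1..r}. \<forall>i<m k.
          ((\<lambda>s. vec_index (transpose_mat (B k) *\<^sub>v block c m (k - 1) (X s \<omega>)) i) has_integral
             vec_index (block c m k (X t \<omega>)) i - vec_index (block c m k x) i) {0..t}))"

definition semigroup_P ::
  "'w measure \<Rightarrow> (real ^ 'n \<Rightarrow> real \<Rightarrow> 'w \<Rightarrow> real ^ 'n) \<Rightarrow> real \<Rightarrow> (real ^ 'n \<Rightarrow> real) \<Rightarrow> real ^ 'n \<Rightarrow> real" where
  "semigroup_P M X t f x = (\<integral>\<omega>. f (X x t \<omega>) \<partial>M)"

text \<open>
  \<open>P\<^sub>t\<close> on nonnegative functions, with values in \<open>[0, \<infinity>]\<close>: for \<open>f\<close> positive, bounded, Lipschitz and \<open>C\<^sup>2\<close>,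
  the function \<open>|\<nabla>f|\<^sup>2 / f\<close> need not be integrable, and the Bochner integral would then be 0.
\<close>

definition semigroup_P_nn ::
  "'w measure \<Rightarrow> (real ^ 'n \<Rightarrow> real \<Rightarrow> 'w \<Rightarrow> real ^ 'n) \<Rightarrow> real \<Rightarrow> (real ^ 'n \<Rightarrow> real) \<Rightarrow> real ^ 'n \<Rightarrow> ennreal" where
  "semigroup_P_nn M X t g x = (\<integral>\<^sup>+\<omega>. ennreal (g (X x t \<omega>)) \<partial>M)"

end

theory Submission
  imports Defs
begin

text \<open>
  The noise enters the equation additively and does not depend on the starting point. Hence two
  solutions driven by the same Brownian motion differ by a solution of the deterministic linear
  equation \<open>D' = B\<^sup>* D\<close>, and almost surely \<open>X\<^sup>y(t) = X\<^sup>x(t) + E(-t) (y - x)\<close>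
  (\<open>diffusion_difference_flow\<close>). Differentiating under the expectation gives the commutation rule
  \<open>\<nabla>P\<^sub>t f = E\<^sup>*(-t) P\<^sub>t \<nabla>f\<close> (\<open>semigroup_has_derivative\<close>).

  Both inequalities then follow from the convexity of \<open>(w, p) \<mapsto> \<langle>Q w, w\<rangle> / p\<close> on \<open>p > 0\<close>, for \<open>Q\<close> symmetric
  and positive semidefinite. Jensen's inequality (\<open>quadratic_form_jensen\<close>), applied to
  \<open>w = E\<^sup>*(-t) \<nabla>f\<close> and \<open>p = f\<close>, reads
  \<open>P\<^sub>t f \<langle>Q \<nabla> ln P\<^sub>t f, \<nabla> ln P\<^sub>t f\<rangle> \<le> P\<^sub>t (f \<langle>E(-t) Q E\<^sup>*(-t) \<nabla> ln f, \<nabla> ln f\<rangle>)\<close>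
  (\<open>semigroup_gradient_bound\<close>). The choice \<open>Q = A\<close> is the first inequality. The choice
  \<open>Q = E(t) A E\<^sup>*(t)\<close> is the second one, since \<open>E(-t) E(t) = 1\<close> turns the matrix on the right into \<open>A\<close>.
\<close>

section \<open>The matrix exponential and linear differential equations\<close>

definition matrix_power :: "real ^ 'n ^ 'n \<Rightarrow> nat \<Rightarrow> real ^ 'n ^ 'n" where
  "matrix_power M k = ((**) M ^^ k) (Finite_Cartesian_Product.mat 1)"

lemma matrix_power_0: "matrix_power M 0 = Finite_Cartesian_Product.mat 1"
  and matrix_power_Suc: "matrix_power M (Suc k) = M ** matrix_power M k"
  by (simp_all add: matrix_power_def)

lemma scaleR_matrix_product: "(a *\<^sub>R M) ** N = a *\<^sub>R (M ** N)"
  and matrix_scaleR_product: "M ** (a *\<^sub>R N) = a *\<^sub>R (M ** N)"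
  for M :: "real ^ 'n ^ 'm" and N :: "real ^ 'p ^ 'n"
  by (simp_all only: matrix_scalar_ac scalar_matrix_assoc)

lemma matrix_matrix_mult_add_rdistrib: "(M + N) ** R = M ** R + N ** R"
  for M N :: "real ^ 'n ^ 'm" and R :: "real ^ 'p ^ 'n"
  by (simp add: matrix_matrix_mult_def Finite_Cartesian_Product.vec_eq_iff distrib_right sum.distrib)

lemma matrix_power_Suc_right: "matrix_power M (Suc k) = matrix_power M k ** M"
proof (induction k)
  case (Suc k)
  then show ?case
    by (metis matrix_mul_assoc matrix_power_Suc)
qed (simp add: matrix_power_0 matrix_power_Suc)

lemma matrix_power_scaleR: "matrix_power (t *\<^sub>R M) k = t ^ k *\<^sub>R matrix_power M k"
  by (induction k)
    (simp_all add: matrix_power_0 matrix_power_Suc scaleR_matrix_product matrix_scaleR_product)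

text \<open>
  The sum of the absolute values of all entries dominates every row sum, so it is a submultiplicative
  bound for the entries. With it the exponential series converges entrywise, and the entries of
  \<open>exp(tM)\<close> are power series in \<open>t\<close> with real coefficients, to which the calculus of such series applies.
\<close>

lemma matrix_power_entry_bound:
  "\<bar>vec_nth (vec_nth (matrix_power M k) i) j\<bar> \<le> (\<Sum>a\<in>UNIV. \<Sum>b\<in>UNIV. \<bar>vec_nth (vec_nth M a) b\<bar>) ^ k"
proof (induction k arbitrary: i)
  case 0
  then show ?case by (simp add: matrix_power_0 Finite_Cartesian_Product.mat_def)
next
  case (Suc k)
  let ?C = "\<Sum>a\<in>UNIV. \<Sum>b\<in>UNIV. \<bar>vec_nth (vec_nth M a) b\<bar>"
  have "\<bar>vec_nth (vec_nth (matrix_power M (Suc k)) i) j\<bar>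
      \<le> (\<Sum>l\<in>UNIV. \<bar>vec_nth (vec_nth M i) l\<bar> * \<bar>vec_nth (vec_nth (matrix_power M k) l) j\<bar>)"
    unfolding matrix_power_Suc matrix_matrix_mult_def
    by (simp add: order.trans[OF sum_abs] abs_mult)
  also have "\<dots> \<le> (\<Sum>l\<in>UNIV. \<bar>vec_nth (vec_nth M i) l\<bar> * ?C ^ k)"
    by (intro sum_mono mult_left_mono Suc.IH) auto
  also have "\<dots> = (\<Sum>l\<in>UNIV. \<bar>vec_nth (vec_nth M i) l\<bar>) * ?C ^ k"
    by (simp add: sum_distrib_right)
  also have "\<dots> \<le> ?C * ?C ^ k"
    by (intro mult_right_mono member_le_sum[where f = "\<lambda>a. \<Sum>b\<in>UNIV. \<bar>vec_nth (vec_nth M a) b\<bar>"])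
      (auto intro!: sum_nonneg zero_le_power)
  finally show ?case by simp
qed

lemma summable_matrix_power_entry:
  "summable (\<lambda>k. vec_nth (vec_nth (matrix_power M k) i) j / fact k * t ^ k)"
proof (rule summable_comparison_test')
  let ?C = "\<Sum>a\<in>UNIV. \<Sum>b\<in>UNIV. \<bar>vec_nth (vec_nth M a) b\<bar>"
  show "summable (\<lambda>k. inverse (fact k) * (?C * \<bar>t\<bar>) ^ k)"
    by (rule summable_exp)
  show "norm (vec_nth (vec_nth (matrix_power M k) i) j / fact k * t ^ k)
      \<le> inverse (fact k) * (?C * \<bar>t\<bar>) ^ k" if "k \<ge> 0" for k
    using mult_right_mono[OF matrix_power_entry_bound[of M k i j], of "\<bar>t\<bar> ^ k / fact k"]
    by (simp add: abs_mult power_abs power_mult_distrib divide_inverse ac_simps)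
qed

lemma matrix_exp_sums: "(\<lambda>k. (1 / fact k) *\<^sub>R matrix_power M k) sums matrix_exp M"
proof -
  have "(\<lambda>k. (1 / fact k) *\<^sub>R matrix_power M k) sums
      (\<chi> i j. \<Sum>k. vec_nth (vec_nth (matrix_power M k) i) j / fact k)"
    unfolding sums_def
    using summable_sums[OF summable_matrix_power_entry[of M _ _ 1]]
    by (intro vec_tendstoI) (simp add: sums_def)
  then show ?thesis
    unfolding matrix_exp_def matrix_power_def[symmetric] by (rule summable_sums[OF sums_summable])
qed

lemma matrix_exp_entry:
  "vec_nth (vec_nth (matrix_exp (t *\<^sub>R M)) i) j =
    (\<Sum>k. vec_nth (vec_nth (matrix_power M k) i) j / fact k * t ^ k)"
proof -
  have "(\<lambda>k. vec_nth (vec_nth (matrix_power M k) i) j / fact k * t ^ k) sums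
      vec_nth (vec_nth (matrix_exp (t *\<^sub>R M)) i) j"
    using sums_vec_nth[OF sums_vec_nth[OF matrix_exp_sums[of "t *\<^sub>R M"]], of i j]
    by (simp add: matrix_power_scaleR mult.commute)
  then show ?thesis by (rule sums_unique)
qed

lemma matrix_exp_0: "matrix_exp 0 = (Finite_Cartesian_Product.mat 1 :: real ^ 'n ^ 'n)"
proof -
  have "vec_nth (vec_nth (matrix_exp (0 *\<^sub>R M)) i) j =
      vec_nth (vec_nth (Finite_Cartesian_Product.mat 1) i) j" for M :: "real ^ 'n ^ 'n" and i j
    unfolding matrix_exp_entry powser_zero by (simp add: matrix_power_0)
  then show ?thesis
    by (simp add: Finite_Cartesian_Product.vec_eq_iff)
qed

lemma matrix_exp_derivative:
  "((\<lambda>t. vec_nth (vec_nth (matrix_exp (t *\<^sub>R M)) i) j) has_real_derivative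
    vec_nth (vec_nth (matrix_exp (t *\<^sub>R M) ** M) i) j) (at t within S)"
proof -
  let ?c = "\<lambda>i j k. vec_nth (vec_nth (matrix_power M k) i) j / fact k"
  have d: "diffs (?c i j) k = (\<Sum>l\<in>UNIV. ?c i l k * vec_nth (vec_nth M l) j)" for k
  proof -
    have cancel: "a * (v / (a * b)) = v / b" if "a \<noteq> 0" for a b v :: real
      using that by simp
    have "diffs (?c i j) k = vec_nth (vec_nth (matrix_power M k ** M) i) j / fact k"
      unfolding diffs_def matrix_power_Suc_right fact_Suc by (rule cancel) simp
    also have "\<dots> = (\<Sum>l\<in>UNIV. ?c i l k * vec_nth (vec_nth M l) j)"
      unfolding matrix_matrix_mult_def by (simp add: sum_divide_distrib)
    finally show ?thesis .
  qed
  have "diffs (?c i j) k * t ^ k = (\<Sum>l\<in>UNIV. (?c i l k * t ^ k) * vec_nth (vec_nth M l) j)" for k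
    unfolding d sum_distrib_right by (rule sum.cong) simp_all
  then have "(\<Sum>k. diffs (?c i j) k * t ^ k) =
      (\<Sum>k. \<Sum>l\<in>UNIV. (?c i l k * t ^ k) * vec_nth (vec_nth M l) j)"
    by (rule suminf_cong)
  also have "\<dots> = (\<Sum>l\<in>UNIV. \<Sum>k. (?c i l k * t ^ k) * vec_nth (vec_nth M l) j)"
    by (rule suminf_sum, rule summable_mult2, rule summable_matrix_power_entry)
  also have "\<dots> = vec_nth (vec_nth (matrix_exp (t *\<^sub>R M) ** M) i) j"
    unfolding matrix_matrix_mult_def
    by (simp only: vec_lambda_beta matrix_exp_entry suminf_mult2[OF summable_matrix_power_entry])
  finally have eq: "(\<Sum>k. diffs (?c i j) k * t ^ k) = vec_nth (vec_nth (matrix_exp (t *\<^sub>R M) ** M) i) j" .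
  have "((\<lambda>t. \<Sum>k. ?c i j k * t ^ k) has_real_derivative (\<Sum>k. diffs (?c i j) k * t ^ k)) (at t within S)"
    by (rule has_field_derivative_at_within, rule termdiffs_strong_converges_everywhere,
        rule summable_matrix_power_entry)
  then show ?thesis
    by (simp only: eq matrix_exp_entry[of _ M i j])
qed

lemma matrix_exp_commute: "matrix_exp (t *\<^sub>R M) ** M = M ** matrix_exp (t *\<^sub>R M)"
proof -
  have bl1: "bounded_linear (\<lambda>N. N ** M)"
    unfolding linear_conv_bounded_linear[symmetric]
    by (intro linearI) (simp_all add: matrix_matrix_mult_add_rdistrib scaleR_matrix_product)
  have bl2: "bounded_linear (\<lambda>N. M ** N)"
    unfolding linear_conv_bounded_linear[symmetric]
    by (intro linearI) (simp_all add: matrix_add_ldistrib matrix_scaleR_product)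
  have "matrix_power (t *\<^sub>R M) k ** M = M ** matrix_power (t *\<^sub>R M) k" for k
    by (simp add: matrix_power_scaleR scaleR_matrix_product matrix_scaleR_product
        flip: matrix_power_Suc matrix_power_Suc_right)
  then show ?thesis
    using bounded_linear.sums[OF bl1 matrix_exp_sums, of "t *\<^sub>R M"]
      bounded_linear.sums[OF bl2 matrix_exp_sums, of "t *\<^sub>R M"]
    by (simp add: scaleR_matrix_product matrix_scaleR_product sums_unique2)
qed

text \<open>
  Uniqueness for \<open>D' = M D\<close> in the form of a conservation law: \<open>exp(-sM) D(s)\<close> has derivative
  \<open>exp(-sM) (-M) D(s) + exp(-sM) M D(s) = 0\<close>. The derivatives are taken within \<open>{0..t}\<close>, because the
  diffusion is only considered at nonnegative times.
\<close>

lemma linear_ode_conserved: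
  fixes M :: "real ^ 'n ^ 'n" and D :: "real \<Rightarrow> real ^ 'n"
  assumes D: "\<And>s i. s \<in> {0..t} \<Longrightarrow>
      ((\<lambda>s. vec_nth (D s) i) has_real_derivative vec_nth (M *v D s) i) (at s within {0..t})"
    and "0 \<le> t"
  shows "matrix_exp ((- t) *\<^sub>R M) *v D t = D 0"
proof -
  have "vec_nth (matrix_exp ((- t) *\<^sub>R M) *v D t) i = vec_nth (D 0) i" for i
  proof -
    \<comment> \<open>\<open>s\<close> is kept as the scalar, so that the derivative of the exponential applies to \<open>- M\<close>.\<close>
    let ?E = "\<lambda>s. matrix_exp (s *\<^sub>R (- M))"
    have "((\<lambda>s. vec_nth (?E s *v D s) i) has_real_derivative 0) (at s within {0..t})"
      if s: "s \<in> {0..t}" for s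
    proof -
      have "((\<lambda>s. vec_nth (?E s *v D s) i) has_real_derivative
          (\<Sum>j\<in>UNIV. vec_nth (vec_nth (?E s ** (- M)) i) j * vec_nth (D s) j
            + vec_nth (M *v D s) j * vec_nth (vec_nth (?E s) i) j)) (at s within {0..t})"
        unfolding matrix_vector_mult_def[of "?E _"]
        by (simp only: vec_lambda_beta) (intro DERIV_sum DERIV_mult matrix_exp_derivative D s)
      also have "(\<Sum>j\<in>UNIV. vec_nth (vec_nth (?E s ** (- M)) i) j * vec_nth (D s) j
            + vec_nth (M *v D s) j * vec_nth (vec_nth (?E s) i) j)
          = vec_nth ((?E s ** (- M)) *v D s + ?E s *v (M *v D s)) i"
        unfolding matrix_vector_mult_def[of "?E s"] matrix_vector_mult_def[of "?E s ** (- M)"]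
        by (simp add: sum.distrib mult.commute)
      also have "(?E s ** (- M)) *v D s + ?E s *v (M *v D s) = ?E s *v ((- M + M) *v D s)"
        by (simp only: matrix_vector_mul_assoc[symmetric] matrix_vector_right_distrib
              matrix_vector_mult_add_rdistrib)
      finally show ?thesis by simp
    qed
    then have "\<exists>C. \<forall>s\<in>{0..t}. vec_nth (?E s *v D s) i = C"
      by (rule has_field_derivative_zero_constant[OF convex_real_interval(5)])
    then obtain C where C: "\<And>s. s \<in> {0..t} \<Longrightarrow> vec_nth (?E s *v D s) i = C"
      by auto
    have "vec_nth (?E t *v D t) i = vec_nth (?E 0 *v D 0) i"
      using C[of t] C[of 0] \<open>0 \<le> t\<close> by simp
    then show ?thesis by (simp add: matrix_exp_0)
  qed
  then show ?thesis by (simp add: Finite_Cartesian_Product.vec_eq_iff)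
qed

text \<open>The conservation law for the particular solution \<open>D(s) = exp(sM) y\<close>.\<close>

lemma matrix_exp_minus_nonneg:
  fixes M :: "real ^ 'n ^ 'n"
  assumes "0 \<le> t"
  shows "matrix_exp ((- t) *\<^sub>R M) ** matrix_exp (t *\<^sub>R M) = Finite_Cartesian_Product.mat 1"
proof (subst matrix_eq, rule allI)
  fix y :: "real ^ 'n"
  have "((\<lambda>s. vec_nth (matrix_exp (s *\<^sub>R M) *v y) i) has_real_derivative
      vec_nth (M *v (matrix_exp (s *\<^sub>R M) *v y)) i) (at s within {0..t})" for s i
  proof -
    have "((\<lambda>s. vec_nth (matrix_exp (s *\<^sub>R M) *v y) i) has_real_derivative
        (\<Sum>j\<in>UNIV. vec_nth (vec_nth (matrix_exp (s *\<^sub>R M) ** M) i) j * vec_nth y j)) (at s within {0..t})"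
      unfolding matrix_vector_mult_def[of "matrix_exp _"]
      by simp (intro DERIV_sum DERIV_cmult_right matrix_exp_derivative)
    then show ?thesis
      unfolding matrix_exp_commute matrix_vector_mul_assoc
      by (simp only: matrix_vector_mult_def[of "M ** _"] vec_lambda_beta)
  qed
  from linear_ode_conserved[of t "\<lambda>s. matrix_exp (s *\<^sub>R M) *v y", OF this \<open>0 \<le> t\<close>]
  show "(matrix_exp ((- t) *\<^sub>R M) ** matrix_exp (t *\<^sub>R M)) *v y = Finite_Cartesian_Product.mat 1 *v y"
    by (simp only: matrix_vector_mul_assoc scaleR_zero_left matrix_exp_0)
qed

section \<open>Differentiation under the expectation\<close>

text \<open>
  The slope of \<open>f\<close> at \<open>z\<close> in the direction of its gradient \<open>v\<close> is \<open>|v|\<^sup>2\<close>, and it is at most \<open>L |v|\<close>.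
\<close>

lemma lipschitz_gradient_bound:
  fixes f :: "'a::euclidean_space \<Rightarrow> real"
  assumes lip: "L-lipschitz_on UNIV f" and f: "(f has_derivative (\<lambda>h. inner v h)) (at z)"
  shows "norm v \<le> L"
proof -
  have line: "((\<lambda>s. z + s *\<^sub>R v) has_derivative (\<lambda>s. s *\<^sub>R v)) (at (0::real))"
    by (auto intro!: derivative_eq_intros)
  have "((\<lambda>s. f (z + s *\<^sub>R v)) has_derivative (\<lambda>s. inner v (s *\<^sub>R v))) (at 0)"
    using has_derivative_compose[OF line, of f "\<lambda>h. inner v h"] f by simp
  then have "((\<lambda>s. f (z + s *\<^sub>R v)) has_real_derivative inner v v) (at 0)"
    by (simp add: has_field_derivative_def mult_commute_abs)
  then have lim: "(\<lambda>s. (f (z + s *\<^sub>R v) - f z) / s) \<midarrow>0\<rightarrow> inner v v"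
    by (simp add: DERIV_def)
  have "\<bar>(f (z + s *\<^sub>R v) - f z) / s\<bar> \<le> L * norm v" if "s \<noteq> 0" for s
    using lipschitz_onD[OF lip, of "z + s *\<^sub>R v" z] that
    by (simp add: dist_real_def dist_norm divide_le_eq ac_simps)
  then have "(f (z + s *\<^sub>R v) - f z) / s \<le> L * norm v" if "s \<noteq> 0" for s
    using that abs_le_D1 by blast
  then have "inner v v \<le> L * norm v"
    by (intro tendsto_upperbound[OF lim]) (auto simp: eventually_at_filter)
  then have "norm v * norm v \<le> L * norm v"
    by (simp add: power2_norm_eq_inner flip: power2_eq_square)
  then show ?thesis
    using lipschitz_on_nonneg[OF lip] by (cases "v = 0") auto
qed

text \<open>
  Dominated convergence: the remainder of the first-order expansion of \<open>f\<close> at \<open>Z\<close>, divided by \<open>|h|\<close>,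
  tends to 0 pointwise and is bounded by \<open>2 L\<close>.
\<close>

lemma has_derivative_expectation_translate:
  fixes f :: "'a::euclidean_space \<Rightarrow> real" and g :: "'a \<Rightarrow> 'a"
  assumes fin: "finite_measure M" and Z: "Z \<in> borel_measurable M"
    and g: "\<And>z. (f has_derivative (\<lambda>h. inner (g z) h)) (at z)"
    and g_meas: "g \<in> borel_measurable borel"
    and lip: "L-lipschitz_on UNIV f" and bdd: "bounded (range f)"
  shows "integrable M (\<lambda>\<omega>. g (Z \<omega>))"
    and "((\<lambda>v. \<integral>\<omega>. f (Z \<omega> + v) \<partial>M) has_derivative (\<lambda>h. inner (\<integral>\<omega>. g (Z \<omega>) \<partial>M) h)) (at 0)"
proof -
  interpret finite_measure M by fact
  have gL: "norm (g z) \<le> L" for z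
    by (rule lipschitz_gradient_bound[OF lip g])
  have gZ[measurable]: "(\<lambda>\<omega>. g (Z \<omega>)) \<in> borel_measurable M"
    using Z g_meas by (rule measurable_compose)
  show int_g: "integrable M (\<lambda>\<omega>. g (Z \<omega>))"
    by (rule integrable_const_bound[of _ L]) (use gL in auto)
  have "continuous_on UNIV f"
    using lip by (rule lipschitz_on_continuous_on)
  then have f_meas: "f \<in> borel_measurable borel"
    by (rule borel_measurable_continuous_onI)
  have fZ[measurable]: "(\<lambda>\<omega>. f (Z \<omega> + v)) \<in> borel_measurable M" for v
    using Z f_meas by measurable
  obtain K where "\<And>z. norm (f z) \<le> K"
    using bdd by (auto simp: bounded_iff)
  then have int_f: "integrable M (\<lambda>\<omega>. f (Z \<omega> + v))" for v
    by (intro integrable_const_bound[of _ K]) auto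
  define R where "R h \<omega> = (f (Z \<omega> + h) - f (Z \<omega>) - inner (g (Z \<omega>)) h) / norm h" for h \<omega>
  have R_meas[measurable]: "R h \<in> borel_measurable M" for h
    using fZ[of h] fZ[of 0] gZ unfolding R_def by simp
  have R_bound: "norm (R h \<omega>) \<le> 2 * L" if "h \<noteq> 0" for h \<omega>
  proof -
    have "\<bar>f (Z \<omega> + h) - f (Z \<omega>)\<bar> \<le> L * norm h"
      using lipschitz_onD[OF lip, of "Z \<omega> + h" "Z \<omega>"] by (simp add: dist_real_def dist_norm)
    moreover have "\<bar>inner (g (Z \<omega>)) h\<bar> \<le> L * norm h"
      using Cauchy_Schwarz_ineq2 mult_right_mono[OF gL norm_ge_zero] by (rule order.trans)
    ultimately show ?thesis
      using that by (simp add: R_def divide_le_eq)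
  qed
  have R_lim: "((\<lambda>h. R h \<omega>) \<longlongrightarrow> 0) (at 0)" for \<omega>
  proof -
    have "((\<lambda>h. norm (R h \<omega>)) \<longlongrightarrow> 0) (at 0)"
      using g[of "Z \<omega>"] unfolding has_derivative_at R_def by simp
    then show ?thesis by (rule tendsto_norm_zero_cancel)
  qed
  have "((\<lambda>h. \<integral>\<omega>. R h \<omega> \<partial>M) \<longlongrightarrow> (\<integral>\<omega>. 0 \<partial>M)) (at 0)"
    unfolding tendsto_at_iff_sequentially comp_def
  proof (intro allI impI)
    fix h :: "nat \<Rightarrow> 'a"
    assume h: "\<forall>i. h i \<in> UNIV - {0}" "h \<longlonglongrightarrow> 0"
    show "(\<lambda>i. \<integral>\<omega>. R (h i) \<omega> \<partial>M) \<longlonglongrightarrow> (\<integral>\<omega>. 0 \<partial>M)"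
    proof (rule integral_dominated_convergence[of _ _ _ "\<lambda>_. 2 * L"])
      show "AE \<omega> in M. (\<lambda>i. R (h i) \<omega>) \<longlonglongrightarrow> 0"
        using R_lim h unfolding tendsto_at_iff_sequentially comp_def by blast
    qed (use R_bound h in auto)
  qed
  then have lim: "((\<lambda>h. norm (\<integral>\<omega>. R h \<omega> \<partial>M)) \<longlongrightarrow> 0) (at 0)"
    by (intro tendsto_norm_zero) simp
  have "norm ((\<integral>\<omega>. f (Z \<omega> + (0 + h)) \<partial>M) - (\<integral>\<omega>. f (Z \<omega> + 0) \<partial>M) - inner (\<integral>\<omega>. g (Z \<omega>) \<partial>M) h) / norm h
      = norm (\<integral>\<omega>. R h \<omega> \<partial>M)" for h
    using int_f[of h] int_f[of 0] int_g by (simp add: R_def)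
  with lim show "((\<lambda>v. \<integral>\<omega>. f (Z \<omega> + v) \<partial>M) has_derivative (\<lambda>h. inner (\<integral>\<omega>. g (Z \<omega>) \<partial>M) h)) (at 0)"
    unfolding has_derivative_at by (simp add: bounded_linear_inner_right)
qed

section \<open>Jensen's inequality for quadratic forms\<close>

lemma ennreal_integral_le_nn_integral:
  assumes "integrable M h"
  shows "ennreal (integral\<^sup>L M h) \<le> (\<integral>\<^sup>+\<omega>. ennreal (h \<omega>) \<partial>M)"
proof -
  have "integral\<^sup>L M h \<le> (\<integral>\<omega>. max 0 (h \<omega>) \<partial>M)"
    using assms by (intro integral_mono) auto
  then have "ennreal (integral\<^sup>L M h) \<le> ennreal (\<integral>\<omega>. max 0 (h \<omega>) \<partial>M)"
    by (rule ennreal_leI)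
  also have "\<dots> = (\<integral>\<^sup>+\<omega>. ennreal (max 0 (h \<omega>)) \<partial>M)"
    using assms by (intro nn_integral_eq_integral[symmetric]) auto
  finally show ?thesis by simp
qed

text \<open>
  The tangent plane of \<open>(w, p) \<mapsto> q(w) / p\<close>, \<open>q(w) = \<langle>Q w, w\<rangle>\<close>, at the mean values lies below the graph;
  this is just \<open>q(w - p u) \<ge> 0\<close> with \<open>u\<close> the quotient of the means. The tangent plane is linear in
  \<open>(w, p)\<close> and touches the graph at the mean values, so integrating it gives the left-hand side. The
  right-hand side is an extended integral because \<open>q(w) / \<phi>\<close> may fail to be integrable.
\<close>

lemma quadratic_form_jensen:
  fixes Q :: "real ^ 'n ^ 'n" and \<phi> :: "'w \<Rightarrow> real" and w :: "'w \<Rightarrow> real ^ 'n"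
  assumes sym: "Finite_Cartesian_Product.transpose Q = Q" and psd: "\<And>v. 0 \<le> inner (Q *v v) v"
    and \<phi>: "integrable M \<phi>" "\<And>\<omega>. 0 < \<phi> \<omega>" "0 < integral\<^sup>L M \<phi>" and w: "integrable M w"
  shows "ennreal (inner (Q *v integral\<^sup>L M w) (integral\<^sup>L M w) / integral\<^sup>L M \<phi>)
    \<le> (\<integral>\<^sup>+\<omega>. ennreal (inner (Q *v w \<omega>) (w \<omega>) / \<phi> \<omega>) \<partial>M)"
proof -
  define u where "u = (1 / integral\<^sup>L M \<phi>) *\<^sub>R integral\<^sup>L M w"
  let ?q = "\<lambda>v. inner (Q *v v) v"
  have cross: "inner (Q *v a) b = inner (Q *v b) a" for a b
    by (metis dot_lmul_matrix inner_commute sym transpose_matrix_vector)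
  have tangent: "2 * inner (Q *v u) (w \<omega>) - \<phi> \<omega> * ?q u \<le> ?q (w \<omega>) / \<phi> \<omega>" for \<omega>
  proof -
    have "0 \<le> ?q (w \<omega> - \<phi> \<omega> *\<^sub>R u)" by (rule psd)
    also have "\<dots> = ?q (w \<omega>) - \<phi> \<omega> * (2 * inner (Q *v u) (w \<omega>) - \<phi> \<omega> * ?q u)"
      using cross[of "w \<omega>" u]
      by (simp add: algebra_simps matrix_vector_mult_scaleR)
    finally show ?thesis using \<phi>(2)[of \<omega>] by (simp add: field_simps)
  qed
  have "?q (integral\<^sup>L M w) / integral\<^sup>L M \<phi>
      = 2 * inner (Q *v u) (integral\<^sup>L M w) - integral\<^sup>L M \<phi> * ?q u"
    using \<phi>(3) by (simp add: u_def matrix_vector_mult_scaleR field_simps)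
  also have "\<dots> = (\<integral>\<omega>. 2 * inner (Q *v u) (w \<omega>) - \<phi> \<omega> * ?q u \<partial>M)"
    using \<phi>(1) w by simp
  also have "ennreal \<dots> \<le> (\<integral>\<^sup>+\<omega>. ennreal (2 * inner (Q *v u) (w \<omega>) - \<phi> \<omega> * ?q u) \<partial>M)"
    using \<phi>(1) w by (intro ennreal_integral_le_nn_integral) auto
  also have "\<dots> \<le> (\<integral>\<^sup>+\<omega>. ennreal (?q (w \<omega>) / \<phi> \<omega>) \<partial>M)"
    by (intro nn_integral_mono ennreal_leI tangent)
  finally show ?thesis .
qed

section \<open>Block matrices and the flow of the diffusion\<close>

lemma gram_matrix_symmetric:
  "Finite_Cartesian_Product.transpose (S ** Finite_Cartesian_Product.transpose S) =
    S ** Finite_Cartesian_Product.transpose S"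
  for S :: "real ^ 'n ^ 'm"
  by (simp add: matrix_transpose_mul)

lemma gram_matrix_psd:
  "0 \<le> inner ((S ** Finite_Cartesian_Product.transpose S) *v v) v"
  for S :: "real ^ 'n ^ 'm"
proof -
  have "inner ((S ** Finite_Cartesian_Product.transpose S) *v v) v = inner v (S *v (v v* S))"
    by (simp add: inner_commute flip: matrix_vector_mul_assoc)
  also have "\<dots> = inner (v v* S) (v v* S)"
    by (rule dot_lmul_matrix[symmetric])
  finally show ?thesis by simp
qed

lemma block_labelling_range:
  assumes "block_labelling r m c"
  shows "fst (c a) \<le> r" and "snd (c a) < m (fst (c a))"
proof -
  have "c a \<in> (SIGMA k:{..r}. {..<m k})"
    using assms unfolding block_labelling_def bij_betw_def by blast
  then show "fst (c a) \<le> r" and "snd (c a) < m (fst (c a))"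
    by (simp_all add: mem_Sigma_iff[of "fst (c a)" "snd (c a)", simplified])
qed

lemma inv_block_labelling:
  assumes "block_labelling r m c" and "k \<le> r" and "j < m k"
  shows "c (inv_into UNIV c (k, j)) = (k, j)"
  using assms by (intro f_inv_into_f) (auto simp: bij_betw_def block_labelling_def)

text \<open>
  Translates sums over the coordinates of \<open>R\<^sup>N\<close> that are restricted to one block into the sums over
  positions in the block that occur in products of \<open>Jordan_Normal_Form\<close> matrices.
\<close>

lemma sum_over_block:
  fixes c :: "'n::finite \<Rightarrow> nat \<times> nat" and h :: "nat \<Rightarrow> 'n \<Rightarrow> real"
  assumes c: "block_labelling r m c" and k: "k \<le> r"
  shows "(\<Sum>a\<in>UNIV. if fst (c a) = k then h (snd (c a)) a else 0) =
    (\<Sum>j<m k. h j (inv_into UNIV c (k, j)))"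
proof -
  have inj: "inj c"
    using c by (auto simp: block_labelling_def bij_betw_def)
  have inv: "inv_into UNIV c (k, snd (c a)) = a" if "fst (c a) = k" for a
    using inv_f_f[OF inj, of a] that by (cases "c a") simp
  have "(\<Sum>a\<in>UNIV. if fst (c a) = k then h (snd (c a)) a else 0) =
      (\<Sum>a | fst (c a) = k. h (snd (c a)) a)"
    by (simp add: sum.If_cases)
  also have "\<dots> = (\<Sum>j<m k. h j (inv_into UNIV c (k, j)))"
    by (rule sum.reindex_bij_witness[of _ "\<lambda>j. inv_into UNIV c (k, j)" "\<lambda>a. snd (c a)"])
      (use block_labelling_range(2)[OF c] in \<open>auto simp: inv_block_labelling[OF c k] inv\<close>)
  finally show ?thesis .
qed

lemma A_matrix_gram:
  assumes c: "block_labelling r m c" and \<sigma>: "\<sigma> \<in> carrier_mat (m 0) (m 0)"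
  shows "A_matrix c (\<sigma> * transpose_mat \<sigma>) =
    A_matrix c \<sigma> ** Finite_Cartesian_Product.transpose (A_matrix c \<sigma>)"
proof -
  have less: "snd (c a) < m 0" if "fst (c a) = 0" for a
    using block_labelling_range(2)[OF c, of a] that by simp
  have "vec_nth (vec_nth (A_matrix c (\<sigma> * transpose_mat \<sigma>)) a) b =
      vec_nth (vec_nth (A_matrix c \<sigma> ** Finite_Cartesian_Product.transpose (A_matrix c \<sigma>)) a) b" for a b
  proof (cases "fst (c a) = 0 \<and> fst (c b) = 0")
    case True
    have "vec_nth (vec_nth (A_matrix c \<sigma> ** Finite_Cartesian_Product.transpose (A_matrix c \<sigma>)) a) b =
        (\<Sum>l\<in>UNIV. if fst (c l) = 0 then \<sigma> $$ (snd (c a), snd (c l)) * \<sigma> $$ (snd (c b), snd (c l)) else 0)"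
      using True by (auto simp: matrix_matrix_mult_def A_matrix_def
          Finite_Cartesian_Product.transpose_def intro!: sum.cong)
    also have "\<dots> = (\<Sum>j<m 0. \<sigma> $$ (snd (c a), j) * \<sigma> $$ (snd (c b), j))"
      by (rule sum_over_block[OF c, of 0 "\<lambda>j _. \<sigma> $$ (snd (c a), j) * \<sigma> $$ (snd (c b), j)"]) simp
    also have "\<dots> = (\<sigma> * transpose_mat \<sigma>) $$ (snd (c a), snd (c b))"
      using \<sigma> less True by (simp add: scalar_prod_def lessThan_atLeast0)
    finally show ?thesis
      using True by (simp add: A_matrix_def)
  qed (auto simp: matrix_matrix_mult_def A_matrix_def Finite_Cartesian_Product.transpose_def)
  then show ?thesis by (simp add: Finite_Cartesian_Product.vec_eq_iff)
qed

text \<open>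
  The drift of the equation, written block by block in \<open>diffusion_from\<close>, is the linear vector field
  \<open>B\<^sup>* z\<close>; on block 0 this field vanishes.
\<close>

lemma drift_block:
  assumes c: "block_labelling r m c" and b: "c b = (k, i)" and k: "k \<in> {1..r}"
    and B: "B k \<in> carrier_mat (m (k - 1)) (m k)" and i: "i < m k"
  shows "vec_index (transpose_mat (B k) *\<^sub>v block c m (k - 1) z) i =
    vec_nth (Finite_Cartesian_Product.transpose (B_matrix c B) *v z) b"
proof -
  have "vec_nth (Finite_Cartesian_Product.transpose (B_matrix c B) *v z) b =
      (\<Sum>a\<in>UNIV. if fst (c a) = k - 1 then B k $$ (snd (c a), i) * vec_nth z a else 0)"
    unfolding matrix_vector_mult_def Finite_Cartesian_Product.transpose_def B_matrix_def
    using b k by (auto intro!: sum.cong)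
  also have "\<dots> = (\<Sum>j<m (k - 1). B k $$ (j, i) * vec_nth z (inv_into UNIV c (k - 1, j)))"
    using k by (intro sum_over_block[OF c]) auto
  also have "\<dots> = vec_index (transpose_mat (B k) *\<^sub>v block c m (k - 1) z) i"
    using B i by (simp add: scalar_prod_def block_def lessThan_atLeast0)
  finally show ?thesis by simp
qed

text \<open>
  In the difference \<open>D\<close> of two solutions the noise cancels on block 0, where \<open>D\<close> is therefore constant;
  on the other blocks the integral equations give \<open>D' = B\<^sup>* D\<close>. So \<open>D(t) = exp(tB\<^sup>*) D(0) = E(-t) D(0)\<close>.
\<close>

lemma diffusion_difference_flow:
  fixes X :: "real ^ 'n \<Rightarrow> real \<Rightarrow> 'w \<Rightarrow> real ^ 'n"
  assumes c: "block_labelling r m c"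
    and B: "\<And>k. k \<in> {1..r} \<Longrightarrow> B k \<in> carrier_mat (m (k - 1)) (m k)"
    and y: "diffusion_from M W c r m \<sigma> B y (X y)" and x: "diffusion_from M W c r m \<sigma> B x (X x)"
    and t: "0 \<le> t"
  shows "AE \<omega> in M. X y t \<omega> = X x t \<omega> + E_matrix (B_matrix c B) (- t) *v (y - x)"
proof -
  define N where "N = Finite_Cartesian_Product.transpose (B_matrix c B)"
  have inj: "inj c"
    using c by (auto simp: block_labelling_def bij_betw_def)
  let ?sol = "\<lambda>z \<omega>. continuous_on {0..} (\<lambda>t. X z t \<omega>) \<and> (\<forall>t\<ge>0.
        block c m 0 (X z t \<omega>) = block c m 0 z + \<sigma> *\<^sub>v Matrix.vec (m 0) (W t \<omega>) \<and>
        (\<forall>k\<in>{1..r}. \<forall>i<m k.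
          ((\<lambda>s. vec_index (transpose_mat (B k) *\<^sub>v block c m (k - 1) (X z s \<omega>)) i) has_integral
             vec_index (block c m k (X z t \<omega>)) i - vec_index (block c m k z) i) {0..t}))"
  have "AE \<omega> in M. ?sol y \<omega>" "AE \<omega> in M. ?sol x \<omega>"
    using x y unfolding diffusion_from_def by (auto elim: AE_mp)
  then show ?thesis
  proof eventually_elim
    case (elim \<omega>)
    have blk: "vec_index (block c m k v) i = vec_nth v b" if "c b = (k, i)" "i < m k" for k i b v
      using that inj by (auto simp: block_def inv_f_eq)
    define D where "D s = X y s \<omega> - X x s \<omega>" for s
    have deriv: "((\<lambda>s. vec_nth (D s) b) has_real_derivative vec_nth (N *v D s) b) (at s within {0..t})"
      and init: "vec_nth (D 0) b = vec_nth (y - x) b" if s: "s \<in> {0..t}" for s b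
    proof -
      obtain k i where b: "c b = (k, i)" by fastforce
      have ki: "k \<le> r" "i < m k"
        using block_labelling_range[OF c, of b] b by auto
      have "((\<lambda>s. vec_nth (D s) b) has_real_derivative vec_nth (N *v D s) b) (at s within {0..t})
        \<and> vec_nth (D 0) b = vec_nth (y - x) b"
      proof (cases "k = 0")
        case True
        have val: "vec_nth (X z u \<omega>) b = vec_nth z b + vec_index (\<sigma> *\<^sub>v Matrix.vec (m 0) (W u \<omega>)) i"
          if "?sol z \<omega>" "0 \<le> u" for z u
        proof -
          have "block c m 0 (X z u \<omega>) = block c m 0 z + \<sigma> *\<^sub>v Matrix.vec (m 0) (W u \<omega>)"
            using that by blast
          then have sum: "vec_index (block c m 0 (X z u \<omega>)) i =
              vec_index (block c m 0 z + \<sigma> *\<^sub>v Matrix.vec (m 0) (W u \<omega>)) i" by simp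
          have "dim_vec (block c m 0 (X z u \<omega>)) = m 0" "dim_vec (block c m 0 z) = m 0"
            by (simp_all add: block_def)
          then have "i < dim_vec (\<sigma> *\<^sub>v Matrix.vec (m 0) (W u \<omega>))"
            using \<open>block c m 0 (X z u \<omega>) = _\<close> ki True
            by (metis index_add_vec(2))
          then show ?thesis
            using sum blk[of b 0 i] b True ki by simp
        qed
        have const: "vec_nth (D u) b = vec_nth (y - x) b" if "0 \<le> u" for u
          using val[of y u] val[of x u] elim that by (simp add: D_def)
        have "vec_nth (N *v D s) b = 0"
          using b True by (simp add: N_def matrix_vector_mult_def Finite_Cartesian_Product.transpose_def B_matrix_def)
        then have "((\<lambda>s. vec_nth (D s) b) has_real_derivative vec_nth (N *v D s) b) (at s within {0..t})"
          using const s
          by (auto intro: has_field_derivative_transform_within[OF DERIV_const[of "vec_nth (y - x) b"], of 1])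
        then show ?thesis using const by simp
      next
        case False
        then have k: "k \<in> {1..r}" using ki by simp
        have int: "((\<lambda>s. vec_nth (N *v X z s \<omega>) b) has_integral vec_nth (X z u \<omega>) b - vec_nth z b) {0..u}"
          if "?sol z \<omega>" "0 \<le> u" for z u
        proof -
          have "((\<lambda>s. vec_index (transpose_mat (B k) *\<^sub>v block c m (k - 1) (X z s \<omega>)) i) has_integral
             vec_index (block c m k (X z u \<omega>)) i - vec_index (block c m k z) i) {0..u}"
            using that k ki by blast
          then show ?thesis
            by (simp only: drift_block[where B = B, OF c b k B[OF k] ki(2)] blk[OF b ki(2)] N_def)
        qed
        have d: "((\<lambda>s. vec_nth (X z s \<omega>) b) has_real_derivative vec_nth (N *v X z s \<omega>) b) (at s within {0..t})"
          if z: "?sol z \<omega>" for z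
        proof -
          have "continuous_on {0..t} (\<lambda>s. vec_nth (N *v X z s \<omega>) b)"
            using z by (intro continuous_on_component linear_continuous_on_compose[OF _ matrix_vector_mul_linear])
              (auto intro: continuous_on_subset)
          then have "((\<lambda>u. integral {0..u} (\<lambda>s. vec_nth (N *v X z s \<omega>) b)) has_real_derivative
              vec_nth (N *v X z s \<omega>) b) (at s within {0..t})"
            using s by (rule integral_has_real_derivative)
          then have "((\<lambda>u. integral {0..u} (\<lambda>s. vec_nth (N *v X z s \<omega>) b) + vec_nth z b) has_real_derivative
              vec_nth (N *v X z s \<omega>) b) (at s within {0..t})"
            using DERIV_add[OF _ DERIV_const[of "vec_nth z b"]] by fastforce
          then show ?thesis
          proof (rule has_field_derivative_transform_within[where d = 1])
            show "integral {0..u} (\<lambda>s. vec_nth (N *v X z s \<omega>) b) + vec_nth z b = vec_nth (X z u \<omega>) b"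
              if "u \<in> {0..t}" for u
              using integral_unique[OF int[OF z, of u]] that by simp
          qed (use s in auto)
        qed
        have "vec_nth (X z 0 \<omega>) b = vec_nth z b" if "?sol z \<omega>" for z
          using integral_unique[OF int[OF that order.refl]] by simp
        then show ?thesis
          using DERIV_diff[OF d d, of y x] elim by (simp add: D_def matrix_vector_mult_diff_distrib)
      qed
      then show "((\<lambda>s. vec_nth (D s) b) has_real_derivative vec_nth (N *v D s) b) (at s within {0..t})"
        and "vec_nth (D 0) b = vec_nth (y - x) b" by blast+
    qed
    have "matrix_exp ((- t) *\<^sub>R N) *v D t = D 0"
      by (rule linear_ode_conserved[OF deriv t])
    moreover have "D 0 = y - x"
      using init[of 0] t by (simp add: Finite_Cartesian_Product.vec_eq_iff)
    moreover have "matrix_exp (t *\<^sub>R N) ** matrix_exp ((- t) *\<^sub>R N) = Finite_Cartesian_Product.mat 1"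
      using matrix_exp_minus_nonneg[OF t, of N] matrix_left_right_inverse by blast
    ultimately have "D t = matrix_exp (t *\<^sub>R N) *v (y - x)"
      by (metis matrix_vector_mul_assoc matrix_vector_mul_lid)
    then show ?case
      by (simp add: D_def N_def E_matrix_def algebra_simps)
  qed
qed

section \<open>The gradient of the semigroup\<close>

lemma grad_ln:
  fixes f :: "real ^ 'n \<Rightarrow> real"
  assumes f: "(f has_derivative (\<lambda>h. inner v h)) (at x)" and pos: "0 < f x"
  shows "grad (\<lambda>z. ln (f z)) x = (1 / f x) *\<^sub>R v"
proof (rule grad_eq)
  show "((\<lambda>z. ln (f z)) has_derivative (\<lambda>h. inner ((1 / f x) *\<^sub>R v) h)) (at x)"
    by (rule has_derivative_eq_rhs[OF has_derivative_ln[OF pos f]])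
      (simp add: fun_eq_iff divide_inverse)
qed

text \<open>
  \<open>P\<^sub>t f(y)\<close> is the expectation of \<open>f\<close> at a translate of the one random vector \<open>X\<^sup>x(t)\<close>, where the
  translation depends linearly on \<open>y - x\<close>; the gradient follows by the chain rule.
\<close>

lemma semigroup_has_derivative:
  fixes f :: "real ^ 'n \<Rightarrow> real" and g :: "real ^ 'n \<Rightarrow> real ^ 'n"
  assumes fin: "finite_measure M" and X: "\<And>y. X y t \<in> borel_measurable M"
    and flow: "\<And>y. AE \<omega> in M. X y t \<omega> = X x t \<omega> + F *v (y - x)"
    and g: "\<And>z. (f has_derivative (\<lambda>h. inner (g z) h)) (at z)"
    and g_meas: "g \<in> borel_measurable borel"
    and lip: "L-lipschitz_on UNIV f" and bdd: "bounded (range f)"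
  shows "(semigroup_P M X t f has_derivative
    (\<lambda>h. inner (Finite_Cartesian_Product.transpose F *v (\<integral>\<omega>. g (X x t \<omega>) \<partial>M)) h)) (at x)"
proof -
  have f_meas: "f \<in> borel_measurable borel"
    using lip by (intro borel_measurable_continuous_onI lipschitz_on_continuous_on)
  have "semigroup_P M X t f y = (\<integral>\<omega>. f (X x t \<omega> + F *v (y - x)) \<partial>M)" for y
    unfolding semigroup_P_def
  proof (rule integral_cong_AE)
    show "(\<lambda>\<omega>. f (X y t \<omega>)) \<in> borel_measurable M"
      using X f_meas by (rule measurable_compose)
    have "(\<lambda>\<omega>. X x t \<omega> + F *v (y - x)) \<in> borel_measurable M"
      using X by simp
    then show "(\<lambda>\<omega>. f (X x t \<omega> + F *v (y - x))) \<in> borel_measurable M"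
      using f_meas by (rule measurable_compose)
    show "AE \<omega> in M. f (X y t \<omega>) = f (X x t \<omega> + F *v (y - x))"
      using flow[of y] by eventually_elim simp
  qed
  then have P: "semigroup_P M X t f = (\<lambda>y. \<integral>\<omega>. f (X x t \<omega> + F *v (y - x)) \<partial>M)"
    by blast
  have affine: "((\<lambda>y. F *v (y - x)) has_derivative (\<lambda>h. F *v h)) (at x)"
    by (rule bounded_linear.has_derivative[OF matrix_vector_mul_bounded_linear])
      (auto intro!: derivative_eq_intros)
  let ?G = "\<integral>\<omega>. g (X x t \<omega>) \<partial>M"
  have "((\<lambda>v. \<integral>\<omega>. f (X x t \<omega> + v) \<partial>M) has_derivative (\<lambda>h. inner ?G h)) (at (F *v (x - x)))"
    using has_derivative_expectation_translate(2)[OF fin X g g_meas lip bdd, of x] by simp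
  from has_derivative_compose[OF affine this]
  show ?thesis
    by (simp add: P dot_lmul_matrix)
qed

text \<open>
  Jensen's inequality for \<open>w = F\<^sup>* \<nabla>f(X\<^sup>x(t))\<close> and \<open>\<phi> = f(X\<^sup>x(t))\<close>, whose means are \<open>\<nabla>P\<^sub>t f(x)\<close> and
  \<open>P\<^sub>t f(x)\<close>; the logarithmic gradients appear on both sides because \<open>\<nabla>f = f \<nabla> ln f\<close>.
\<close>

lemma semigroup_gradient_bound:
  fixes f :: "real ^ 'n \<Rightarrow> real" and Q :: "real ^ 'n ^ 'n"
  assumes prob: "prob_space M" and X: "\<And>y. X y t \<in> borel_measurable M"
    and flow: "\<And>y. AE \<omega> in M. X y t \<omega> = X x t \<omega> + F *v (y - x)"
    and C2: "C2_function f" and pos: "\<And>z. 0 < f z"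
    and lip: "L-lipschitz_on UNIV f" and bdd: "bounded (range f)"
    and sym: "Finite_Cartesian_Product.transpose Q = Q" and psd: "\<And>v. 0 \<le> inner (Q *v v) v"
  shows "ennreal (semigroup_P M X t f x *
      inner (Q *v grad (\<lambda>y. ln (semigroup_P M X t f y)) x) (grad (\<lambda>y. ln (semigroup_P M X t f y)) x))
    \<le> semigroup_P_nn M X t (\<lambda>y. f y *
        inner ((F ** Q ** Finite_Cartesian_Product.transpose F) *v grad (\<lambda>z. ln (f z)) y)
          (grad (\<lambda>z. ln (f z)) y)) x"
proof -
  interpret prob_space M by fact
  let ?FT = "Finite_Cartesian_Product.transpose F"
  let ?Z = "X x t"
  obtain g :: "real ^ 'n \<Rightarrow> real ^ 'n" and H :: "real ^ 'n \<Rightarrow> real ^ 'n ^ 'n"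
    where g: "\<And>z. (f has_derivative (\<lambda>h. inner (g z) h)) (at z)"
      and H: "\<And>z. (g has_derivative (\<lambda>h. H z *v h)) (at z)"
    using C2 unfolding C2_function_def by blast
  have g_meas: "g \<in> borel_measurable borel"
    using has_derivative_continuous[OF H]
    by (intro borel_measurable_continuous_onI) (simp add: continuous_on_eq_continuous_at)
  have f_meas: "f \<in> borel_measurable borel"
    using lip by (intro borel_measurable_continuous_onI lipschitz_on_continuous_on)
  have fZ: "(\<lambda>\<omega>. f (?Z \<omega>)) \<in> borel_measurable M"
    using X f_meas by (rule measurable_compose)
  obtain K where "\<And>z. norm (f z) \<le> K"
    using bdd by (auto simp: bounded_iff)
  then have int_f: "integrable M (\<lambda>\<omega>. f (?Z \<omega>))"
    using fZ by (intro integrable_const_bound[of _ K]) auto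
  have int_g: "integrable M (\<lambda>\<omega>. g (?Z \<omega>))"
    by (rule has_derivative_expectation_translate(1)[OF finite_measure_axioms X g g_meas lip bdd])
  let ?p = "\<integral>\<omega>. f (?Z \<omega>) \<partial>M" and ?G = "\<integral>\<omega>. g (?Z \<omega>) \<partial>M"
  have p_pos: "0 < ?p"
  proof -
    have "?p \<noteq> 0"
      using integral_nonneg_eq_0_iff_AE[OF int_f] pos by (simp add: less_imp_le order_less_imp_not_eq2)
    moreover have "0 \<le> ?p"
      using pos by (simp add: less_imp_le)
    ultimately show ?thesis by simp
  qed
  have P: "semigroup_P M X t f x = ?p"
    by (simp add: semigroup_P_def)
  have grad_P: "grad (\<lambda>y. ln (semigroup_P M X t f y)) x = (1 / ?p) *\<^sub>R (?FT *v ?G)"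
    using grad_ln[OF semigroup_has_derivative[where X = X and t = t and x = x and F = F, OF finite_measure_axioms X flow g g_meas lip bdd]] p_pos
    by (simp add: P)
  have int_w: "integrable M (\<lambda>\<omega>. ?FT *v g (?Z \<omega>))"
    by (rule integrable_bounded_linear[OF matrix_vector_mul_bounded_linear int_g])
  have G: "?FT *v ?G = (\<integral>\<omega>. ?FT *v g (?Z \<omega>) \<partial>M)"
    by (rule integral_bounded_linear[OF matrix_vector_mul_bounded_linear int_g, symmetric])
  have push: "inner (Q *v (?FT *v v)) (?FT *v v) = inner ((F ** Q ** ?FT) *v v) v" for v
  proof -
    have "inner (Q *v (?FT *v v)) (?FT *v v) = inner (v v* F) (Q *v (v v* F))"
      by (simp add: inner_commute)
    also have "\<dots> = inner v (F *v (Q *v (?FT *v v)))"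
      by (simp add: dot_lmul_matrix)
    also have "\<dots> = inner ((F ** Q ** ?FT) *v v) v"
      by (simp only: matrix_vector_mul_assoc matrix_mul_assoc inner_commute)
    finally show ?thesis .
  qed
  have "semigroup_P M X t f x * inner (Q *v grad (\<lambda>y. ln (semigroup_P M X t f y)) x)
      (grad (\<lambda>y. ln (semigroup_P M X t f y)) x) = inner (Q *v (?FT *v ?G)) (?FT *v ?G) / ?p"
    unfolding grad_P P using p_pos by (simp only: matrix_vector_mult_scaleR inner_scaleR_left inner_scaleR_right) simp
  also have "ennreal \<dots> \<le> (\<integral>\<^sup>+\<omega>. ennreal (inner (Q *v (?FT *v g (?Z \<omega>))) (?FT *v g (?Z \<omega>)) / f (?Z \<omega>)) \<partial>M)"
    unfolding G by (rule quadratic_form_jensen[OF sym psd int_f pos p_pos int_w])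
  also have "\<dots> = semigroup_P_nn M X t (\<lambda>y. f y *
        inner ((F ** Q ** ?FT) *v grad (\<lambda>z. ln (f z)) y) (grad (\<lambda>z. ln (f z)) y)) x"
  proof -
    have "inner (Q *v (?FT *v g z)) (?FT *v g z) / f z =
        f z * inner ((F ** Q ** ?FT) *v grad (\<lambda>z. ln (f z)) z) (grad (\<lambda>z. ln (f z)) z)" for z
      unfolding grad_ln[OF g pos] push using pos[of z]
      by (simp only: matrix_vector_mult_scaleR inner_scaleR_left inner_scaleR_right) simp
    then show ?thesis by (simp only: semigroup_P_nn_def)
  qed
  finally show ?thesis .
qed

section \<open>The two gradient bounds\<close>

theorem corollary2p10:
  fixes r :: nat and m :: "nat \<Rightarrow> nat"
    and \<sigma> A\<^sub>0 :: "real Matrix.mat" and Bk :: "nat \<Rightarrow> real Matrix.mat"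
    and c :: "'n::finite \<Rightarrow> nat \<times> nat"
    and M :: "'w measure" and W :: "real \<Rightarrow> 'w \<Rightarrow> nat \<Rightarrow> real"
    and X :: "real ^ 'n \<Rightarrow> real \<Rightarrow> 'w \<Rightarrow> real ^ 'n"
    and f :: "real ^ 'n \<Rightarrow> real"
    and t :: real and x :: "real ^ 'n"
  defines "A \<equiv> A_matrix c A\<^sub>0"
    and "E \<equiv> E_matrix (B_matrix c Bk)"
    and "P \<equiv> semigroup_P M X"
    and "Pnn \<equiv> semigroup_P_nn M X"
  assumes "r \<ge> 1" and "\<forall>k<r. m (Suc k) \<le> m k" and "m r \<ge> 1"
    and "block_labelling r m c"
    and "\<sigma> \<in> carrier_mat (m 0) (m 0)" and "A\<^sub>0 = \<sigma> * transpose_mat \<sigma>"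
    and "\<forall>k\<in>{1..r}. Bk k \<in> carrier_mat (m (k - 1)) (m k) \<and> vec_space.rank (m (k - 1)) (Bk k) = m k"
    and "std_brownian_motion M (m 0) W"
    and "\<forall>y. diffusion_from M W c r m \<sigma> Bk y (X y)"
    and "C2_function f" and "\<forall>y. f y > 0"
    and "\<exists>L. L-lipschitz_on UNIV f" and "bounded (range f)"
    and "t \<ge> 0"
  shows "ennreal (2 * P t f x * carre_du_champ A (\<lambda>y. ln (P t f y)) x)
           \<le> Pnn t (\<lambda>y. f y *
               inner ((E (- t) ** A ** Finite_Cartesian_Product.transpose (E (- t))) *v grad (\<lambda>z. ln (f z)) y)
                 (grad (\<lambda>z. ln (f z)) y)) x \<and>
         ennreal (P t f x *
             inner ((E t ** A ** Finite_Cartesian_Product.transpose (E t)) *v grad (\<lambda>y. ln (P t f y)) x)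
               (grad (\<lambda>y. ln (P t f y)) x))
           \<le> 2 * Pnn t (\<lambda>y. f y * carre_du_champ A (\<lambda>z. ln (f z)) y) x"
proof -
  define F where "F = E (- t)"
  have prob: "prob_space M"
    using \<open>std_brownian_motion M (m 0) W\<close> by (simp add: std_brownian_motion_def)
  have X: "X y t \<in> borel_measurable M" for y
    using \<open>\<forall>y. diffusion_from M W c r m \<sigma> Bk y (X y)\<close> \<open>t \<ge> 0\<close> by (simp add: diffusion_from_def)
  have flow: "AE \<omega> in M. X y t \<omega> = X x t \<omega> + F *v (y - x)" for y
    unfolding F_def E_def using assms by (intro diffusion_difference_flow) auto
  obtain L where lip: "L-lipschitz_on UNIV f"
    using \<open>\<exists>L. L-lipschitz_on UNIV f\<close> by blast
  have pos: "\<And>z. 0 < f z"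
    using \<open>\<forall>y. f y > 0\<close> by blast
  note bound = semigroup_gradient_bound[where X = X and t = t and x = x and F = F, OF prob X flow \<open>C2_function f\<close> pos lip \<open>bounded (range f)\<close>,
      folded P_def Pnn_def]
  define S where "S = A_matrix c \<sigma>"
  have A: "A = S ** Finite_Cartesian_Product.transpose S"
    unfolding A_def S_def \<open>A\<^sub>0 = \<sigma> * transpose_mat \<sigma>\<close>
    by (rule A_matrix_gram) fact+
  let ?dP = "grad (\<lambda>y. ln (P t f y)) x" and ?df = "grad (\<lambda>z. ln (f z))"
  have "ennreal (P t f x * inner (A *v ?dP) ?dP)
      \<le> Pnn t (\<lambda>y. f y * inner ((F ** A ** Finite_Cartesian_Product.transpose F) *v ?df y) (?df y)) x"
    unfolding A by (rule bound[OF gram_matrix_symmetric gram_matrix_psd])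
  then have first: "ennreal (2 * P t f x * carre_du_champ A (\<lambda>y. ln (P t f y)) x)
      \<le> Pnn t (\<lambda>y. f y * inner ((E (- t) ** A ** Finite_Cartesian_Product.transpose (E (- t))) *v ?df y) (?df y)) x"
    by (simp add: carre_du_champ_def F_def)
  \<comment> \<open>The factor 1/2 in \<open>\<Gamma>\<close> is put into the Gram factor, so that the 2 in front of the extended integral on
      the right need not be moved across that integral.\<close>
  define R where "R = sqrt (1 / 2) *\<^sub>R (E t ** S)"
  have ES: "E t ** A ** Finite_Cartesian_Product.transpose (E t) =
      2 *\<^sub>R (R ** Finite_Cartesian_Product.transpose R)"
    by (simp add: A R_def matrix_transpose_mul matrix_mul_assoc transpose_scalar
        scaleR_matrix_product matrix_scaleR_product)
  have FE: "F ** E t = Finite_Cartesian_Product.mat 1"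
    using matrix_exp_minus_nonneg[OF \<open>t \<ge> 0\<close>] matrix_left_right_inverse
    by (auto simp: F_def E_def E_matrix_def)
  have FR: "F ** R = sqrt (1 / 2) *\<^sub>R S"
    by (simp add: R_def matrix_scaleR_product matrix_mul_assoc FE)
  have "F ** (R ** Finite_Cartesian_Product.transpose R) ** Finite_Cartesian_Product.transpose F =
      (F ** R) ** Finite_Cartesian_Product.transpose (F ** R)"
    by (simp add: matrix_transpose_mul matrix_mul_assoc)
  also have "\<dots> = (1 / 2) *\<^sub>R A"
    unfolding FR by (simp add: A transpose_scalar scaleR_matrix_product matrix_scaleR_product)
  finally have "f y * inner ((F ** (R ** Finite_Cartesian_Product.transpose R) **
        Finite_Cartesian_Product.transpose F) *v ?df y) (?df y) =
      f y * carre_du_champ A (\<lambda>z. ln (f z)) y" for y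
    by (simp add: carre_du_champ_def flip: scaleR_matrix_vector_assoc)
  then have half: "ennreal (P t f x * inner ((R ** Finite_Cartesian_Product.transpose R) *v ?dP) ?dP)
      \<le> Pnn t (\<lambda>y. f y * carre_du_champ A (\<lambda>z. ln (f z)) y) x"
    using bound[OF gram_matrix_symmetric[of R] gram_matrix_psd[of R]] by (simp only:)
  have "P t f x * inner ((E t ** A ** Finite_Cartesian_Product.transpose (E t)) *v ?dP) ?dP =
      2 * (P t f x * inner ((R ** Finite_Cartesian_Product.transpose R) *v ?dP) ?dP)"
    unfolding ES by (simp flip: scaleR_matrix_vector_assoc)
  then have "ennreal (P t f x * inner ((E t ** A ** Finite_Cartesian_Product.transpose (E t)) *v ?dP) ?dP) =
      2 * ennreal (P t f x * inner ((R ** Finite_Cartesian_Product.transpose R) *v ?dP) ?dP)"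
    by (simp only: ennreal_mult'[of 2] zero_le_numeral ennreal_numeral)
  also have "\<dots> \<le> 2 * Pnn t (\<lambda>y. f y * carre_du_champ A (\<lambda>z. ln (f z)) y) x"
    using half by (rule mult_left_mono) simp
  finally show ?thesis using first by blast
qed

end
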